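(* Let $m\geq t\geq 3$ be integers with $t$ even. Then there exists a signed magic array $SMA(m,2m;2t,t)$.
   Context: For positive integers $m,n,s,t$, a signed magic array $SMA(m,n;s,t)$ is an $m\times n$ array ($m$ rows, $n$ columns), some of whose cells may be empty, with entries from the set $X$, where $X=\{0,\pm1,\pm2,\ldots,\pm (ms-1)/2\}$ if $ms$ is odd and $X=\{\pm1,\pm2,\ldots,\pm ms/2\}$ if $ms$ is even, such that precisely $s$ cells in every row and precisely $t$ cells in every column are filled, every integer in $X$ appears exactly once in the array, and the sum of each row and of each column is zero. *)

theory Defs
  imports Main
begin

definition sma_entries :: "nat \<Rightarrow> nat \<Rightarrow> int set" where
  "sma_entries m s =
     (if odd (m * s)
      then {- ((int m * int s - 1) div 2) .. (int m * int s - 1) div 2}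
      else {- (int m * int s div 2) .. int m * int s div 2} - {0})"

text \<open>
  An array is a function giving the content of cell \<open>(i, j)\<close>, where \<open>None\<close> means that the
  cell is empty. Rows are indexed by \<open>0, \<dots>, m - 1\<close> and columns by \<open>0, \<dots>, n - 1\<close>; values of
  the function outside this range are irrelevant.
\<close>

definition filled_in_row :: "nat \<Rightarrow> (nat \<Rightarrow> nat \<Rightarrow> int option) \<Rightarrow> nat \<Rightarrow> nat set" where
  "filled_in_row n A i = {j. j < n \<and> A i j \<noteq> None}"

definition filled_in_col :: "nat \<Rightarrow> (nat \<Rightarrow> nat \<Rightarrow> int option) \<Rightarrow> nat \<Rightarrow> nat set" where
  "filled_in_col m A j = {i. i < m \<and> A i j \<noteq> None}"

definition is_SMA ::
  "nat \<Rightarrow> nat \<Rightarrow> nat \<Rightarrow> nat \<Rightarrow> (nat \<Rightarrow> nat \<Rightarrow> int option) \<Rightarrow> bool" where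
  "is_SMA m n s t A \<longleftrightarrow>
     m > 0 \<and> n > 0 \<and> s > 0 \<and> t > 0 \<and>
     (\<forall>i<m. \<forall>j<n. \<forall>x. A i j = Some x \<longrightarrow> x \<in> sma_entries m s) \<and>
     (\<forall>i<m. card (filled_in_row n A i) = s) \<and>
     (\<forall>j<n. card (filled_in_col m A j) = t) \<and>
     (\<forall>x\<in>sma_entries m s. \<exists>!p. p \<in> {..<m} \<times> {..<n} \<and> A (fst p) (snd p) = Some x) \<and>
     (\<forall>i<m. (\<Sum>j\<in>filled_in_row n A i. the (A i j)) = 0) \<and>
     (\<forall>j<n. (\<Sum>i\<in>filled_in_col m A j. the (A i j)) = 0)"

end

theory Submission
  imports Defs
begin

text \<open>
  Column \<open>a\<close> is given the label \<open>a + 1\<close> and column \<open>m + a\<close> the label \<open>2 m - a\<close>, for \<open>a < m\<close>.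
  Going cyclically downwards from row \<open>a\<close>, a column with label \<open>v\<close> reads
  \<open>-v, v, -(v + 2 m), v + 2 m, -(v + 4 m), v + 4 m, \<dots>\<close> (\<open>t\<close> entries), so that its sum
  vanishes. The labels of columns \<open>a\<close> and \<open>m + a\<close> add up to \<open>2 m + 1\<close>, independently of \<open>a\<close>;
  hence in every row the columns at cyclic distances \<open>2 k\<close> and \<open>2 k + 1\<close> from the row cancel.
\<close>

text \<open>The difference is taken in \<open>int\<close> because subtraction in \<open>nat\<close>
  would truncate when \<open>i < j\<close>. Reduction modulo \<open>m\<close> lets columns
  \<open>a\<close> and \<open>m + a\<close> both start in row \<open>a\<close>.\<close>

definition offset :: "nat \<Rightarrow> nat \<Rightarrow> nat \<Rightarrow> nat" where
  "offset m i j = nat ((int i - int j) mod int m)"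

text \<open>One less than the label of column \<open>j\<close>.\<close>

definition label :: "nat \<Rightarrow> nat \<Rightarrow> nat" where
  "label m j = (if j < m then j else 3 * m - 1 - j)"

text \<open>The absolute value minus one has low digit \<open>label m j\<close> and high digit
  \<open>d div 2\<close> in base \<open>2 * m\<close>; the parity of \<open>d\<close> is stored in
  the sign.\<close>

definition entry :: "nat \<Rightarrow> nat \<Rightarrow> nat \<Rightarrow> int" where
  "entry m d j = (if even d then - 1 else 1) * (int (label m j + 2 * m * (d div 2)) + 1)"

definition cyclic_array :: "nat \<Rightarrow> nat \<Rightarrow> nat \<Rightarrow> nat \<Rightarrow> int option" where
  "cyclic_array m t i j =
     (if offset m i j < t then Some (entry m (offset m i j) j) else None)"

lemma offset_less: "m > 0 \<Longrightarrow> offset m i j < m"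
  by (simp add: offset_def nat_less_iff)

lemma offset_add: "offset m i (m + j) = offset m i j"
proof -
  have "(int i - int (m + j)) mod int m = (int i - int j - int m) mod int m"
    by (simp add: algebra_simps)
  then show ?thesis by (simp add: offset_def)
qed

lemma mod_eq_imp_eq:
  fixes a b :: nat
  assumes "a < m" "b < m" "int m dvd int a - int b"
  shows "a = b"
proof (rule ccontr)
  assume "a \<noteq> b"
  then have "\<bar>int m\<bar> \<le> \<bar>int a - int b\<bar>"
    using assms by (intro dvd_imp_le_int) auto
  with assms show False by auto
qed

lemma bij_betw_offset_row:
  assumes "m > 0"
  shows "bij_betw (\<lambda>i. offset m i j) {..<m} {..<m}"
proof -
  have "inj_on (\<lambda>i. offset m i j) {..<m}"
  proof (rule inj_onI)
    fix i i' assume *: "i \<in> {..<m}" "i' \<in> {..<m}" "offset m i j = offset m i' j"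
    then have "(int i - int j) mod int m = (int i' - int j) mod int m"
      using assms by (simp add: offset_def eq_nat_nat_iff)
    then have "int m dvd int i - int i'"
      by (simp add: mod_eq_dvd_iff)
    then show "i = i'" using * mod_eq_imp_eq by auto
  qed
  moreover have "(\<lambda>i. offset m i j) ` {..<m} \<subseteq> {..<m}"
    using assms offset_less by auto
  ultimately show ?thesis
    by (simp add: bij_betw_def endo_inj_surj)
qed

lemma bij_betw_offset_col:
  assumes "m > 0"
  shows "bij_betw (offset m i) {..<m} {..<m}"
proof -
  have "inj_on (offset m i) {..<m}"
  proof (rule inj_onI)
    fix j j' assume *: "j \<in> {..<m}" "j' \<in> {..<m}" "offset m i j = offset m i j'"
    then have "(int i - int j) mod int m = (int i - int j') mod int m"
      using assms by (simp add: offset_def eq_nat_nat_iff)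
    then have "int m dvd int j' - int j"
      by (simp add: mod_eq_dvd_iff)
    then show "j = j'" using * mod_eq_imp_eq[of j' m j] by simp
  qed
  moreover have "offset m i ` {..<m} \<subseteq> {..<m}"
    using assms offset_less by auto
  ultimately show ?thesis
    by (simp add: bij_betw_def endo_inj_surj)
qed

text \<open>This cuts the offset bijections down to the filled cells, which are those with offset
  below \<open>t\<close>.\<close>

lemma bij_betw_restrict_preimage:
  assumes "bij_betw f A B" "C \<subseteq> B"
  shows "bij_betw f {x \<in> A. f x \<in> C} C"
  using assms by (auto simp: bij_betw_def inj_on_def)

lemma label_less: "j < 2 * m \<Longrightarrow> label m j < 2 * m"
  by (auto simp: label_def)

lemma label_inj:
  assumes "label m j = label m j'" "j < 2 * m" "j' < 2 * m"
  shows "j = j'"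
  using assms by (auto simp: label_def split: if_splits)

text \<open>The added 1 keeps the absolute value positive, so the sign reveals the parity of
  \<open>d\<close>. Division by \<open>2 * m\<close> then separates \<open>d div 2\<close> from the
  label, which determines \<open>j\<close>.\<close>

lemma inj_on_entry: "inj_on (\<lambda>(d, j). entry m d j) ({..<t} \<times> {..<2 * m})"
proof (rule inj_onI, clarify)
  fix d j d' j' assume j: "j < 2 * m" "j' < 2 * m" and eq: "entry m d j = entry m d' j'"
  let ?f = "\<lambda>d j. label m j + 2 * m * (d div 2)"
  have par: "even d = even d'" and val: "?f d j = ?f d' j'"
    using eq by (auto simp: entry_def simp del: of_nat_add of_nat_mult split: if_splits)
  have "d div 2 = ?f d j div (2 * m)"
    using j label_less by simp
  also have "\<dots> = d' div 2"
    unfolding val using j label_less by simp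
  finally have half: "d div 2 = d' div 2" .
  moreover have "d mod 2 = d' mod 2"
    using par by (simp add: mod2_eq_if)
  ultimately have "d = d'"
    by (metis div_mult_mod_eq)
  with half val label_inj j show "d = d' \<and> j = j'" by auto
qed

text \<open>Surjectivity comes from counting: the image lies in the target, and both sets have
  \<open>2 * m * t\<close> elements. Evenness of \<open>t\<close> makes the largest absolute value
  exactly \<open>m * t\<close>.\<close>

lemma bij_betw_entry:
  assumes "even t"
  shows "bij_betw (\<lambda>(d, j). entry m d j) ({..<t} \<times> {..<2 * m}) (sma_entries m (2 * t))"
proof -
  let ?D = "{..<t} \<times> {..<2 * m}" and ?N = "int (m * t)"
  have X: "sma_entries m (2 * t) = {- ?N..?N} - {0}"
    by (simp add: sma_entries_def)
  have sub: "(\<lambda>(d, j). entry m d j) ` ?D \<subseteq> sma_entries m (2 * t)"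
  proof (rule image_subsetI)
    fix p assume "p \<in> ?D"
    then obtain d j where p: "p = (d, j)" "d < t" "j < 2 * m" by auto
    then have "label m j + 1 \<le> 2 * m" "d div 2 + 1 \<le> t div 2"
      using label_less[of j m] assms by auto
    then have "label m j + 1 + 2 * m * (d div 2) \<le> 2 * m * (d div 2 + 1)"
      by (simp add: algebra_simps)
    also have "\<dots> \<le> 2 * m * (t div 2)"
      using \<open>d div 2 + 1 \<le> t div 2\<close> by (rule mult_le_mono2)
    also have "\<dots> = m * t" using assms by auto
    finally have "int (label m j + 2 * m * (d div 2)) + 1 \<le> ?N"
      by linarith
    then show "(case p of (d, j) \<Rightarrow> entry m d j) \<in> sma_entries m (2 * t)"
      unfolding X entry_def p(1) by (auto simp del: of_nat_add of_nat_mult)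
  qed
  have "card ({- ?N..?N} - {0}) = 2 * m * t"
    by (simp add: card_Diff_singleton del: of_nat_mult)
  then have "(\<lambda>(d, j). entry m d j) ` ?D = sma_entries m (2 * t)"
    using sub inj_on_entry[of m t] by (intro card_subset_eq) (auto simp: X card_image)
  with inj_on_entry show ?thesis by (simp add: bij_betw_def)
qed

text \<open>The terms for \<open>d = 2 * k\<close> and \<open>d = 2 * k + 1\<close> share the value
  \<open>g k\<close> and have opposite signs. Row sums and column sums both reduce to this.\<close>

lemma sum_alternating_halves:
  fixes g :: "nat \<Rightarrow> int"
  assumes "even t"
  shows "(\<Sum>d<t. (if even d then - 1 else 1) * g (d div 2)) = 0"
proof -
  obtain k where "t = 2 * k" using assms by blast
  moreover have "(\<Sum>d<2 * k. (if even d then - 1 else 1) * g (d div 2)) = 0"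
    by (induction k) auto
  ultimately show ?thesis by simp
qed

lemma cyclic_array_row:
  assumes "m > 0" "t \<le> m" "even t"
  shows "card (filled_in_row (2 * m) (cyclic_array m t) i) = 2 * t"
    and "(\<Sum>j\<in>filled_in_row (2 * m) (cyclic_array m t) i. the (cyclic_array m t i j)) = 0"
proof -
  \<comment> \<open>\<open>S\<close> collects the filled columns of the left half; by
    \<open>offset_add\<close> those of the right half are its translate by \<open>m\<close>.\<close>
  define S where "S = {a \<in> {..<m}. offset m i a \<in> {..<t}}"
  have bij: "bij_betw (offset m i) S {..<t}"
    unfolding S_def using assms by (intro bij_betw_restrict_preimage[OF bij_betw_offset_col]) auto
  have fin: "finite S" unfolding S_def by simp
  have row: "filled_in_row (2 * m) (cyclic_array m t) i = S \<union> (+) m ` S"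
  proof (intro set_eqI iffI)
    fix j assume "j \<in> filled_in_row (2 * m) (cyclic_array m t) i"
    then have j: "j < 2 * m" "offset m i j < t"
      by (auto simp: filled_in_row_def cyclic_array_def split: if_splits)
    show "j \<in> S \<union> (+) m ` S"
    proof (cases "j < m")
      case False
      then have "j = m + (j - m)" "j - m < m" using j by auto
      moreover from this have "offset m i (j - m) < t"
        using j offset_add by metis
      ultimately show ?thesis unfolding S_def by blast
    qed (use j S_def in auto)
  next
    fix j assume "j \<in> S \<union> (+) m ` S"
    then show "j \<in> filled_in_row (2 * m) (cyclic_array m t) i"
      by (auto simp: S_def filled_in_row_def cyclic_array_def offset_add)
  qed
  have disj: "S \<inter> (+) m ` S = {}" by (auto simp: S_def)
  have "card S = t" using bij by (auto dest: bij_betw_same_card)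
  then show "card (filled_in_row (2 * m) (cyclic_array m t) i) = 2 * t"
    using fin disj by (simp add: row card_Un_disjoint card_image)
  \<comment> \<open>Columns \<open>a\<close> and \<open>m + a\<close> have equal offset
    \<open>d\<close> and hence equal sign. With \<open>k = d div 2\<close>, their absolute values
    add up to \<open>(2 * m - 1) + 2 + 2 * (2 * m * k)\<close>, which no longer involves
    \<open>a\<close>.\<close>
  let ?g = "\<lambda>k. 2 * int m + 1 + 4 * int m * int k"
  have "(\<Sum>j\<in>filled_in_row (2 * m) (cyclic_array m t) i. the (cyclic_array m t i j))
      = (\<Sum>a\<in>S. the (cyclic_array m t i a) + the (cyclic_array m t i (m + a)))"
    using fin disj by (simp add: row sum.union_disjoint sum.reindex sum.distrib)
  also have "\<dots> = (\<Sum>a\<in>S. (if even (offset m i a) then - 1 else 1) * ?g (offset m i a div 2))"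
  proof (rule sum.cong)
    fix a assume "a \<in> S"
    then have a: "a < m" "offset m i a < t" by (auto simp: S_def)
    have "int (label m a) + int (label m (m + a)) + 1 = 2 * int m"
      using a(1) by (simp add: label_def of_nat_diff)
    then show "the (cyclic_array m t i a) + the (cyclic_array m t i (m + a))
        = (if even (offset m i a) then - 1 else 1) * ?g (offset m i a div 2)"
      using a by (simp add: cyclic_array_def offset_add entry_def)
  qed simp
  also have "\<dots> = (\<Sum>d<t. (if even d then - 1 else 1) * ?g (d div 2))"
    by (rule sum.reindex_bij_betw[OF bij])
  also have "\<dots> = 0" using assms(3) by (rule sum_alternating_halves)
  finally show "(\<Sum>j\<in>filled_in_row (2 * m) (cyclic_array m t) i. the (cyclic_array m t i j)) = 0" .
qed

text \<open>Since \<open>t \<le> m\<close>, each offset below \<open>t\<close> occurs in exactly one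
  row of the column. The label is constant along the column, so consecutive offsets cancel in
  pairs.\<close>

lemma cyclic_array_col:
  assumes "m > 0" "t \<le> m" "even t"
  shows "card (filled_in_col m (cyclic_array m t) j) = t"
    and "(\<Sum>i\<in>filled_in_col m (cyclic_array m t) j. the (cyclic_array m t i j)) = 0"
proof -
  define S where "S = {i \<in> {..<m}. offset m i j \<in> {..<t}}"
  have bij: "bij_betw (\<lambda>i. offset m i j) S {..<t}"
    unfolding S_def using assms by (intro bij_betw_restrict_preimage[OF bij_betw_offset_row]) auto
  have col: "filled_in_col m (cyclic_array m t) j = S"
    by (auto simp: S_def filled_in_col_def cyclic_array_def)
  show "card (filled_in_col m (cyclic_array m t) j) = t"
    using bij by (auto simp: col dest: bij_betw_same_card)
  have "(\<Sum>i\<in>S. the (cyclic_array m t i j)) = (\<Sum>i\<in>S. entry m (offset m i j) j)"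
    by (rule sum.cong) (auto simp: S_def cyclic_array_def)
  also have "\<dots> = (\<Sum>d<t. entry m d j)"
    by (rule sum.reindex_bij_betw[OF bij])
  also have "\<dots> = 0"
    unfolding entry_def using assms(3) by (rule sum_alternating_halves)
  finally show "(\<Sum>i\<in>filled_in_col m (cyclic_array m t) j. the (cyclic_array m t i j)) = 0"
    by (simp add: col)
qed

text \<open>The value \<open>x\<close> determines the offset and the column by
  \<open>bij_betw_entry\<close>, and within that column the offset determines the row.\<close>

lemma cyclic_array_ex1:
  assumes "m > 0" "t \<le> m" "even t" "x \<in> sma_entries m (2 * t)"
  shows "\<exists>!p. p \<in> {..<m} \<times> {..<2 * m} \<and> cyclic_array m t (fst p) (snd p) = Some x"
proof -
  obtain d j where dj: "d < t" "j < 2 * m" "x = entry m d j"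
    using bij_betw_imp_surj_on[OF bij_betw_entry[OF assms(3), of m]] assms(4) by (force simp: image_iff)
  have "d \<in> (\<lambda>i. offset m i j) ` {..<m}"
    using bij_betw_imp_surj_on[OF bij_betw_offset_row[OF assms(1), of j]] dj(1) assms(2) by auto
  then obtain i where i: "i < m" "offset m i j = d" by auto
  show ?thesis
  proof (rule ex1I[of _ "(i, j)"])
    fix p assume p: "p \<in> {..<m} \<times> {..<2 * m} \<and> cyclic_array m t (fst p) (snd p) = Some x"
    obtain i' j' where [simp]: "p = (i', j')" by (cases p)
    have *: "i' < m" "j' < 2 * m" "offset m i' j' < t" "entry m (offset m i' j') j' = entry m d j"
      using p dj by (auto simp: cyclic_array_def split: if_splits)
    then have "(offset m i' j', j') = (d, j)"
      using inj_onD[OF inj_on_entry[of m t], of "(offset m i' j', j')" "(d, j)"] dj by force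
    then have "j' = j" "offset m i' j' = offset m i j'" using i(2) by auto
    then show "p = (i, j)"
      using inj_onD[OF bij_betw_imp_inj_on[OF bij_betw_offset_row[OF assms(1), of j]]] * i by auto
  qed (use dj i in \<open>auto simp: cyclic_array_def\<close>)
qed

theorem theorem12:
  fixes m t :: nat
  assumes "t \<ge> 3" and "m \<ge> t" and "even t"
  shows "\<exists>A. is_SMA m (2 * m) (2 * t) t A"
proof
  have m: "m > 0" using assms by simp
  have "x \<in> sma_entries m (2 * t)" if "j < 2 * m" "cyclic_array m t i j = Some x" for i j x
    using that bij_betwE[OF bij_betw_entry[OF assms(3), of m]]
    by (auto simp: cyclic_array_def split: if_splits)
  then show "is_SMA m (2 * m) (2 * t) t (cyclic_array m t)"
    unfolding is_SMA_def
    using assms m cyclic_array_row[OF m assms(2,3)] cyclic_array_col[OF m assms(2,3)]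
      cyclic_array_ex1[OF m assms(2,3)]
    by auto
qed

end
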